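(* Let $\mathcal H$ be a finite-dimensional complex Hilbert space, let $V\in\mathcal B(\mathcal H)$ be such that $p:=C_{\mathrm{Ad}_V}\in\mathcal B(\mathcal H\otimes\mathcal H)$ is a (rank one) projection, and let $\lambda>0$. If $\frac1\lambda\ge 4\,\|p\|_{S(1)}$, then the map $(\mathrm{Tr}-\lambda\,\mathrm{Ad}_V)^{\otimes 2}:\mathcal B(\mathcal H\otimes\mathcal H)\to\mathcal B(\mathcal H\otimes\mathcal H)$ is $2$-positive.
   Context: $\mathrm{Ad}_V(x)=VxV^*$, and $\mathrm{Tr}-\lambda\,\mathrm{Ad}_V$ denotes the map $x\mapsto\mathrm{Tr}(x)\mathbf 1-\lambda VxV^*$ on $\mathcal B(\mathcal H)$. The Choi matrix of a linear map $\phi$ on $\mathcal B(\mathcal H)$ is $C_\phi=\sum_{i,j}e_{ij}\otimes\phi(e_{ij})\in\mathcal B(\mathcal H\otimes\mathcal H)$, with $(e_{ij})$ the matrix units of a fixed orthonormal basis $(e_i)$ of $\mathcal H$. A linear map $\phi$ is $k$-positive if $\phi\otimes\mathrm{id}_{M_k(\mathbb C)}$ is positive (maps positive semidefinite operators to positive semidefinite operators). For a positive operator $A\in\mathcal B(\mathcal H\otimes\mathcal H)$, $\|A\|_{S(k)}=\sup\langle\psi|A|\psi\rangle$, where the supremum is over unit vectors $\psi=\sum_{i,j}\psi_{ij}e_i\otimes e_j\in\mathcal H\otimes\mathcal H$ of Schmidt rank $\le k$, i.e. such that the matrix $[\psi_{ij}]$ has rank $\le k$. *)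

theory Defs
  imports "HOL-Analysis.Analysis"
begin

text \<open>
  A finite-dimensional complex Hilbert space with a fixed orthonormal basis is \<open>complex^'n\<close>
  with the standard basis; operators on it are matrices \<open>complex^'n^'n\<close>, where \<open>A $ i $ j\<close> is the
  entry in row \<open>i\<close> and column \<open>j\<close>. The tensor product of the spaces with index types \<open>'a\<close> and
  \<open>'b\<close> has index type \<open>'a \<times> 'b\<close>, the pair \<open>(i, j)\<close> standing for \<open>e_i \<otimes> e_j\<close>. The library norm on
  \<open>complex^'n\<close> is the one induced by \<open>cinner\<close> below (lemma \<open>cinner_self\<close>).
\<close>

definition cinner :: "complex^'n \<Rightarrow> complex^'n \<Rightarrow> complex" where
  "cinner x y = (\<Sum>i\<in>UNIV. cnj (x $ i) * y $ i)"

definition adj :: "complex^'n^'m \<Rightarrow> complex^'m^'n" where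
  "adj A = (\<chi> i j. cnj (A $ j $ i))"

definition psd :: "complex^'n^'n \<Rightarrow> bool" where
  "psd A \<longleftrightarrow> (\<forall>x. Im (cinner x (A *v x)) = 0 \<and> 0 \<le> Re (cinner x (A *v x)))"

definition projection :: "complex^'n^'n \<Rightarrow> bool" where
  "projection P \<longleftrightarrow> P ** P = P \<and> adj P = P"

definition munit :: "'n \<Rightarrow> 'n \<Rightarrow> complex^'n^'n" where
  "munit i j = (\<chi> k l. if k = i \<and> l = j then 1 else 0)"

definition kron :: "complex^'a^'a \<Rightarrow> complex^'b^'b \<Rightarrow> complex^('a \<times> 'b)^('a \<times> 'b)" where
  "kron A B = (\<chi> r c. A $ fst r $ fst c * B $ snd r $ snd c)"

text \<open>The library's \<open>*s\<close> scales a vector by an element of its component type, so it is not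
  the complex scaling of a matrix.\<close>

definition mscale :: "complex \<Rightarrow> complex^'n^'m \<Rightarrow> complex^'n^'m" where
  "mscale c A = (\<chi> i j. c * A $ i $ j)"

abbreviation mlinear :: "(complex^'a^'a \<Rightarrow> complex^'b^'b) \<Rightarrow> bool" where
  "mlinear \<equiv> Vector_Spaces.linear mscale mscale"

text \<open>The tensor product of two linear maps, given by its values on the basis
  \<open>e_ij \<otimes> e_kl\<close>; by \<open>mlinear_tensor_map\<close> and \<open>tensor_map_kron\<close> it is the linear map sending
  \<open>A \<otimes> B\<close> to \<open>\<phi> A \<otimes> \<psi> B\<close>.\<close>

definition tensor_map ::
  "(complex^'a^'a \<Rightarrow> complex^'c^'c) \<Rightarrow> (complex^'b^'b \<Rightarrow> complex^'d^'d) \<Rightarrow>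
    complex^('a \<times> 'b)^('a \<times> 'b) \<Rightarrow> complex^('c \<times> 'd)^('c \<times> 'd)" where
  "tensor_map \<phi> \<psi> X =
    (\<Sum>i\<in>UNIV. \<Sum>j\<in>UNIV. \<Sum>k\<in>UNIV. \<Sum>l\<in>UNIV.
      mscale (X $ (i, k) $ (j, l)) (kron (\<phi> (munit i j)) (\<psi> (munit k l))))"

definition positive_map :: "(complex^'a^'a \<Rightarrow> complex^'b^'b) \<Rightarrow> bool" where
  "positive_map \<phi> \<longleftrightarrow> (\<forall>X. psd X \<longrightarrow> psd (\<phi> X))"

text \<open>\<open>k\<close>-positivity, the number \<open>k\<close> being the cardinality of the index type \<open>'k\<close>.\<close>

definition k_positive :: "'k::finite itself \<Rightarrow> (complex^'a^'a \<Rightarrow> complex^'b^'b) \<Rightarrow> bool" where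
  "k_positive _ \<phi> \<longleftrightarrow>
    mlinear \<phi> \<and> positive_map (tensor_map \<phi> (id :: complex^'k^'k \<Rightarrow> complex^'k^'k))"

definition Ad :: "complex^'n^'n \<Rightarrow> complex^'n^'n \<Rightarrow> complex^'n^'n" where
  "Ad V X = V ** X ** adj V"

definition Tr_minus_Ad :: "real \<Rightarrow> complex^'n^'n \<Rightarrow> complex^'n^'n \<Rightarrow> complex^'n^'n" where
  "Tr_minus_Ad c V X = mscale (trace X) (mat 1) - mscale (of_real c) (Ad V X)"

definition choi :: "(complex^'n^'n \<Rightarrow> complex^'n^'n) \<Rightarrow> complex^('n \<times> 'n)^('n \<times> 'n)" where
  "choi \<phi> = (\<Sum>i\<in>UNIV. \<Sum>j\<in>UNIV. kron (munit i j) (\<phi> (munit i j)))"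

definition schmidt_rank :: "complex^('a::finite \<times> 'b::finite) \<Rightarrow> nat" where
  "schmidt_rank \<psi> = rank (\<chi> i j. \<psi> $ (i, j))"

text \<open>For \<open>k \<ge> 1\<close> the set below is nonempty, and it is always bounded above
  (lemma \<open>bdd_above_S_norm\<close>). For positive \<open>A\<close>, taking the real part loses nothing.\<close>

definition S_norm :: "nat \<Rightarrow> complex^('a::finite \<times> 'b::finite)^('a \<times> 'b) \<Rightarrow> real" where
  "S_norm k A = Sup {Re (cinner \<psi> (A *v \<psi>)) | \<psi>. norm \<psi> = 1 \<and> schmidt_rank \<psi> \<le> k}"

lemma cinner_self: "cinner x x = of_real ((norm x)\<^sup>2)"
proof -
  have "cinner x x = (\<Sum>i\<in>UNIV. of_real ((norm (x $ i))\<^sup>2))"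
    unfolding cinner_def
    by (intro sum.cong refl) (simp only: complex_norm_square mult.commute)
  then show ?thesis
    by (simp add: norm_vec_def L2_set_def sum_nonneg)
qed

lemma vector_space_mscale: "vector_space (mscale :: complex \<Rightarrow> complex^'n^'m \<Rightarrow> _)"
  by unfold_locales (simp_all add: mscale_def vec_eq_iff algebra_simps)

lemma mlinear_iff:
  "mlinear \<phi> \<longleftrightarrow> (\<forall>X Y. \<phi> (X + Y) = \<phi> X + \<phi> Y) \<and> (\<forall>c X. \<phi> (mscale c X) = mscale c (\<phi> X))"
  by (simp add: Vector_Spaces.linear_iff vector_space_mscale)

lemma mscale_sum: "mscale c (sum f S) = (\<Sum>x\<in>S. mscale c (f x))"
  by (simp add: mscale_def vec_eq_iff sum_distrib_left)

lemma mlinear_tensor_map: "mlinear (tensor_map \<phi> \<psi>)"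
  by (simp add: mlinear_iff tensor_map_def mscale_sum)
    (simp add: mscale_def vec_eq_iff algebra_simps sum.distrib)

lemma mlinear_expand:
  fixes \<phi> :: "complex^'a^'a \<Rightarrow> complex^'b^'b"
  assumes "mlinear \<phi>"
  shows "\<phi> X = (\<Sum>i\<in>UNIV. \<Sum>j\<in>UNIV. mscale (X $ i $ j) (\<phi> (munit i j)))"
proof -
  have add: "\<phi> (A + B) = \<phi> A + \<phi> B" and scale: "\<phi> (mscale c A) = mscale c (\<phi> A)" for A B c
    using assms by (auto simp: mlinear_iff)
  have zero: "\<phi> 0 = 0"
    using add[of 0 0] by simp
  have sum: "\<phi> (sum f S) = (\<Sum>x\<in>S. \<phi> (f x))" if "finite S" for f and S :: "'a set"
    using that by (induction S rule: finite_induct) (simp_all add: add zero)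
  have "X = (\<Sum>i\<in>UNIV. \<Sum>j\<in>UNIV. mscale (X $ i $ j) (munit i j))"
  proof -
    have "(\<Sum>i\<in>UNIV. \<Sum>j\<in>UNIV. X $ i $ j * (if k = i \<and> l = j then 1 else 0)) = X $ k $ l" for k l
    proof -
      have "(\<Sum>j\<in>UNIV. X $ i $ j * (if k = i \<and> l = j then 1 else 0))
          = (if k = i then X $ i $ l else 0)" for i
        by (simp add: if_distrib cong: if_cong)
      then show ?thesis by simp
    qed
    then show ?thesis
      by (simp add: mscale_def munit_def vec_eq_iff)
  qed
  then have "\<phi> X = \<phi> (\<Sum>i\<in>UNIV. \<Sum>j\<in>UNIV. mscale (X $ i $ j) (munit i j))"
    by simp
  then show ?thesis
    by (simp add: sum scale)
qed

lemma tensor_map_kron: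
  assumes "mlinear \<phi>" "mlinear \<psi>"
  shows "tensor_map \<phi> \<psi> (kron A B) = kron (\<phi> A) (\<psi> B)"
  unfolding mlinear_expand[OF assms(1), of A] mlinear_expand[OF assms(2), of B]
  by (simp add: tensor_map_def vec_eq_iff kron_def mscale_def sum_distrib_right)
    (simp add: sum_distrib_left mult_ac)

lemma mlinear_Tr_minus_Ad: "mlinear (Tr_minus_Ad c V)"
  by (simp add: mlinear_iff Tr_minus_Ad_def Ad_def)
    (simp add: mscale_def vec_eq_iff mat_def trace_def matrix_matrix_mult_def algebra_simps
      sum.distrib sum_distrib_left sum_distrib_right)

lemma bdd_above_S_norm:
  "bdd_above {Re (cinner \<psi> (A *v \<psi>)) | \<psi>. norm \<psi> = 1 \<and> schmidt_rank \<psi> \<le> k}"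
proof (rule bdd_aboveI)
  fix r assume "r \<in> {Re (cinner \<psi> (A *v \<psi>)) | \<psi>. norm \<psi> = 1 \<and> schmidt_rank \<psi> \<le> k}"
  then obtain \<psi> where r: "r = Re (cinner \<psi> (A *v \<psi>))" and n: "norm \<psi> = 1" by blast
  have le1: "norm (\<psi> $ i) \<le> 1" for i
    using Finite_Cartesian_Product.norm_nth_le[of \<psi> i] n by simp
  have "r \<le> norm (cinner \<psi> (A *v \<psi>))"
    using complex_Re_le_cmod r by blast
  also have "\<dots> \<le> (\<Sum>i\<in>UNIV. norm (cnj (\<psi> $ i) * (\<Sum>j\<in>UNIV. A $ i $ j * \<psi> $ j)))"
    unfolding cinner_def matrix_vector_mult_def by (simp add: norm_sum del: norm_mult)
  also have "\<dots> \<le> (\<Sum>i\<in>UNIV. \<Sum>j\<in>UNIV. norm (A $ i $ j))"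
  proof (rule sum_mono)
    fix i
    have "norm (\<Sum>j\<in>UNIV. A $ i $ j * \<psi> $ j) \<le> (\<Sum>j\<in>UNIV. norm (A $ i $ j))"
      by (rule sum_norm_le) (simp add: norm_mult mult_left_le le1)
    then have "norm (\<psi> $ i) * norm (\<Sum>j\<in>UNIV. A $ i $ j * \<psi> $ j) \<le> 1 * (\<Sum>j\<in>UNIV. norm (A $ i $ j))"
      by (intro mult_mono le1) auto
    then show "norm (cnj (\<psi> $ i) * (\<Sum>j\<in>UNIV. A $ i $ j * \<psi> $ j)) \<le> (\<Sum>j\<in>UNIV. norm (A $ i $ j))"
      by (simp add: norm_mult)
  qed
  finally show "r \<le> (\<Sum>i\<in>UNIV. \<Sum>j\<in>UNIV. norm (A $ i $ j))" .
qed

end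

(*
  A positive matrix is a sum of rank one matrices z z^*, so it suffices to bound the quadratic
  form of the image of z z^* below. With z = (z_1, z_2), x = (x_1, x_2) and
  psi = sum_k z_k (x) cnj x_k, that form at x is
    |psi|^2 - lam |A|^2 - lam |B|^2 + lam^2 |C|^2,
  where A and B contract one tensor factor of psi with V, and C contracts both.
  If S is the S(1)-norm of p, the operator norm of V is at most sqrt S, hence
  |A|^2 <= S |psi|^2 when psi is an elementary tensor. Since psi is a sum of two elementary
  tensors, which may be taken orthogonal, |A|^2 <= 2 S |psi|^2, and likewise for B. As
  4 lam S <= 1, the first three terms have a nonnegative sum.
*)
theory Submission
  imports Defs
begin

section \<open>Positive semidefinite matrices as sums of rank one matrices\<close>

lemma cinner_add_left: "cinner (x + y) z = cinner x z + cinner y z"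
  by (simp add: cinner_def algebra_simps sum.distrib)

lemma cinner_add_right: "cinner x (y + z) = cinner x y + cinner x z"
  by (simp add: cinner_def algebra_simps sum.distrib)

lemma cinner_scale_left: "cinner (c *s x) y = cnj c * cinner x y"
  by (simp add: cinner_def sum_distrib_left mult_ac)

lemma cinner_scale_right: "cinner x (c *s y) = c * cinner x y"
  by (simp add: cinner_def sum_distrib_left mult_ac)

lemma cinner_axis_left: "cinner (axis i 1) y = y $ i"
  by (simp add: cinner_def axis_def if_distrib if_distribR cong: if_cong)

lemma matrix_vector_axis: "(A *v axis i 1) $ j = A $ j $ i" for A :: "complex^'n^'m"
  by (simp add: matrix_vector_mult_def axis_def if_distrib cong: if_cong)

lemma quadratic_form_shift:
  fixes Z :: "complex^'n^'n"
  shows "cinner (x + s *s axis i 1) (Z *v (x + s *s axis i 1)) =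
    cinner x (Z *v x) + s * cinner x (Z *v axis i 1) + cnj s * (Z *v x) $ i
      + s * cnj s * Z $ i $ i"
  by (simp add: cinner_add_left cinner_add_right cinner_scale_left cinner_scale_right
      matrix_vector_right_distrib vector_scalar_commute cinner_axis_left
      matrix_vector_axis algebra_simps)

lemma psd_diag:
  assumes "psd Z"
  shows "Im (Z $ i $ i) = 0" "0 \<le> Re (Z $ i $ i)"
  using assms[unfolded psd_def, rule_format, of "axis i 1"]
  by (simp_all add: cinner_axis_left matrix_vector_axis)

text \<open>Polarization: \<open>psd\<close> only demands a real quadratic form, and its values at
  \<open>axis j 1 + s *s axis i 1\<close> recover the off-diagonal entries.\<close>

lemma psd_hermitian:
  assumes "psd Z"
  shows "Z $ j $ i = cnj (Z $ i $ j)"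
proof -
  have "Im (Z $ j $ j + s * Z $ j $ i + cnj s * Z $ i $ j + s * cnj s * Z $ i $ i) = 0" for s
    using assms[unfolded psd_def, rule_format, of "axis j 1 + s *s axis i 1"]
    unfolding quadratic_form_shift by (simp add: cinner_axis_left matrix_vector_axis)
  \<comment> \<open>\<open>s = 1\<close> compares the imaginary parts of the two entries,
    \<open>s = \<i>\<close> their real parts.\<close>
  from this[of 1] this[of \<i>] show ?thesis
    using psd_diag[OF assms] by (simp add: complex_eq_iff)
qed

text \<open>With a zero diagonal entry the form at \<open>axis j 1 + s *s axis i 1\<close> is affine
  in \<open>s\<close>; being bounded below, it has no linear part.\<close>

lemma psd_zero_diag:
  assumes "psd Z" and "Z $ i $ i = 0"
  shows "Z $ i $ j = 0"
proof (rule ccontr)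
  assume nz: "Z $ i $ j \<noteq> 0"
  define N where "N = (cmod (Z $ i $ j))\<^sup>2"
  \<comment> \<open>Chosen so that the form takes the value -1 at
    \<open>s = - t * Z $ i $ j\<close>.\<close>
  define t where "t = (Re (Z $ j $ j) + 1) / (2 * N)"
  have N: "N > 0" using nz by (simp add: N_def)
  have "0 \<le> Re (Z $ j $ j + s * Z $ j $ i + cnj s * Z $ i $ j)" for s
    using assms(1)[unfolded psd_def, rule_format, of "axis j 1 + s *s axis i 1"] assms(2)
    unfolding quadratic_form_shift by (simp add: cinner_axis_left matrix_vector_axis)
  from this[of "- (of_real t * Z $ i $ j)"]
  have "0 \<le> Re (Z $ j $ j) - 2 * t * N"
    unfolding psd_hermitian[OF assms(1), of j i]
    unfolding N_def cmod_power2 by (simp add: algebra_simps power2_eq_square)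
  also have "2 * t * N = Re (Z $ j $ j) + 1"
    using N by (simp add: t_def)
  finally show False by simp
qed

definition outer :: "complex^'n \<Rightarrow> complex^'n^'n" where
  "outer z = (\<chi> i j. z $ i * cnj (z $ j))"

text \<open>One step of a Cholesky decomposition: \<open>z\<close> is column \<open>i\<close>
  divided by the square root of the pivot, and \<open>Y\<close> is the Schur complement padded with
  zeros. The strict inclusion supplies a decreasing measure for induction.\<close>

lemma psd_schur_complement:
  fixes Z :: "complex^'n^'n"
  assumes Z: "psd Z" and nz: "Z $ i $ i \<noteq> 0"
  obtains z Y where "Z = Y + outer z" "psd Y" "{j. Y $ j $ j \<noteq> 0} \<subset> {j. Z $ j $ j \<noteq> 0}"
proof -
  define d where "d = Re (Z $ i $ i)"
  have dZ: "Z $ i $ i = of_real d"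
    using psd_diag[OF Z] by (simp add: d_def complex_eq_iff)
  have d: "d > 0"
  proof -
    have "d \<noteq> 0" using nz dZ by auto
    moreover have "0 \<le> d" unfolding d_def by (rule psd_diag(2)[OF Z])
    ultimately show ?thesis by simp
  qed
  define z :: "complex^'n" where "z = (\<chi> j. Z $ j $ i / of_real (sqrt d))"
  have zz: "z $ j * cnj (z $ k) = Z $ j $ i * Z $ i $ k / of_real d" for j k
  proof -
    have "complex_of_real (sqrt d) * of_real (sqrt d) = of_real d"
      using d by (simp flip: of_real_mult)
    then show ?thesis
      using psd_hermitian[OF Z, of k i] by (simp add: z_def)
  qed
  define Y where "Y = Z - outer z"
  have Yjk: "Y $ j $ k = Z $ j $ k - Z $ j $ i * Z $ i $ k / of_real d" for j k
    by (simp add: Y_def outer_def zz)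
  have "psd Y"
    unfolding psd_def
  proof
    fix x :: "complex^'n"
    \<comment> \<open>The form of \<open>Z\<close> along \<open>x + s *s axis i 1\<close> is minimal
      at \<open>s = - t\<close>, and its minimum is the form of \<open>Y\<close> at
      \<open>x\<close>.\<close>
    define t where "t = (Z *v x) $ i / of_real d"
    have c: "cinner x (Z *v axis i 1) = cnj ((Z *v x) $ i)"
      using psd_hermitian[OF Z, of _ i]
      by (simp add: cinner_def matrix_vector_axis matrix_vector_mult_def[of Z x] mult.commute)
    have "cinner x (Y *v x) = cinner x (Z *v x) - cinner x (Z *v axis i 1) * (Z *v x) $ i / of_real d"
    proof -
      have "(Y *v x) $ j = (Z *v x) $ j - Z $ j $ i * (Z *v x) $ i / of_real d" for j
        by (simp add: matrix_vector_mult_def Yjk algebra_simps sum_subtractf sum_distrib_left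
            sum_divide_distrib)
      then show ?thesis
        by (simp add: cinner_def matrix_vector_axis right_diff_distrib sum_subtractf
            sum_distrib_right sum_divide_distrib mult.assoc)
    qed
    also have "\<dots> = cinner (x + (- t) *s axis i 1) (Z *v (x + (- t) *s axis i 1))"
      unfolding quadratic_form_shift c dZ using d by (simp add: t_def field_simps)
    finally show "Im (cinner x (Y *v x)) = 0 \<and> 0 \<le> Re (cinner x (Y *v x))"
      using Z[unfolded psd_def] by metis
  qed
  moreover have "Y $ i $ i = 0"
    using d by (simp add: Yjk dZ)
  \<comment> \<open>A zero diagonal entry of \<open>Z\<close> kills its whole row, so the
    subtraction creates no new nonzero diagonal entry.\<close>
  moreover have "Y $ j $ j = 0" if "Z $ j $ j = 0" for j
    using psd_zero_diag[OF Z that] that by (simp add: Yjk)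
  ultimately show ?thesis
    using that[of Y z] nz by (force simp: Y_def)
qed

text \<open>Each Schur complement lowers the number of nonzero diagonal entries; when none is left,
  all entries vanish and the matrix is 0.\<close>

lemma psd_induct [consumes 1, case_names zero add]:
  fixes Z :: "complex^'n^'n"
  assumes "psd Z" and zero: "P 0" and add: "\<And>Y z. P Y \<Longrightarrow> P (Y + outer z)"
  shows "P Z"
  using assms(1)
proof (induction "card {j. Z $ j $ j \<noteq> 0}" arbitrary: Z rule: less_induct)
  case less
  show ?case
  proof (cases "\<exists>i. Z $ i $ i \<noteq> 0")
    case True
    then obtain i where i: "Z $ i $ i \<noteq> 0" by blast
    obtain z Y where Y: "Z = Y + outer z" "psd Y" "{j. Y $ j $ j \<noteq> 0} \<subset> {j. Z $ j $ j \<noteq> 0}"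
      by (rule psd_schur_complement[OF less.prems i])
    have "P Y"
      by (rule less.hyps[OF psubset_card_mono[OF finite Y(3)] Y(2)])
    then show ?thesis
      unfolding Y(1) by (rule add)
  next
    case False
    then have "Z $ i $ i = 0" for i by simp
    then have "Z $ i $ j = 0" for i j
      by (rule psd_zero_diag[OF less.prems])
    then have "Z = 0"
      by (simp add: vec_eq_iff)
    then show ?thesis using zero by simp
  qed
qed

lemma psd_add: "psd A \<Longrightarrow> psd B \<Longrightarrow> psd (A + B)"
  by (simp add: psd_def matrix_vector_mult_add_rdistrib cinner_add_right)

lemma psd_zero: "psd 0"
  by (simp add: psd_def cinner_def)

lemma positive_map_outerI:
  fixes \<phi> :: "complex^'a^'a \<Rightarrow> complex^'b^'b"
  assumes "mlinear \<phi>" and "\<And>z. psd (\<phi> (outer z))"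
  shows "positive_map \<phi>"
  unfolding positive_map_def
proof (intro allI impI)
  fix Z :: "complex^'a^'a" assume "psd Z"
  have map_add: "\<phi> (A + B) = \<phi> A + \<phi> B" for A B
    using assms(1) by (auto simp: mlinear_iff)
  from \<open>psd Z\<close> show "psd (\<phi> Z)"
  proof (induction Z rule: psd_induct)
    case zero
    show ?case using map_add[of 0 0] by (simp add: psd_zero)
  next
    case (add Y z)
    then show ?case by (simp add: map_add psd_add assms(2))
  qed
qed

section \<open>Squared norms and orthogonal tensors\<close>

text \<open>Stated for functions rather than vectors, so that tuples of indices can be regrouped by
  pattern abstractions.\<close>

definition sqnorm :: "('a::finite \<Rightarrow> complex) \<Rightarrow> real" where
  "sqnorm f = (\<Sum>a\<in>UNIV. (cmod (f a))\<^sup>2)"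

lemma sqnorm_nonneg: "0 \<le> sqnorm f"
  by (simp add: sqnorm_def sum_nonneg)

lemma sqnorm_eq_0_iff: "sqnorm f = 0 \<longleftrightarrow> (\<forall>a. f a = 0)"
  by (simp add: sqnorm_def sum_nonneg_eq_0_iff)

lemma complex_of_real_sqnorm: "complex_of_real (sqnorm f) = (\<Sum>a\<in>UNIV. f a * cnj (f a))"
  by (simp only: sqnorm_def of_real_sum complex_norm_square)

lemma sqnorm_prod: "sqnorm f = (\<Sum>a\<in>UNIV. sqnorm (\<lambda>b. f (a, b)))"
  by (simp add: sqnorm_def sum.cartesian_product)

lemma sqnorm_prod': "sqnorm f = (\<Sum>b\<in>UNIV. sqnorm (\<lambda>a. f (a, b)))"
  unfolding sqnorm_prod[of f] unfolding sqnorm_def by (rule sum.swap)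

lemma sqnorm_add_le: "sqnorm (\<lambda>a. f a + g a) \<le> 2 * (sqnorm f + sqnorm g)"
proof -
  have "(cmod (f a + g a))\<^sup>2 \<le> 2 * ((cmod (f a))\<^sup>2 + (cmod (g a))\<^sup>2)" for a
  proof -
    have "(cmod (f a + g a))\<^sup>2 \<le> (cmod (f a) + cmod (g a))\<^sup>2"
      by (simp add: norm_triangle_ineq power_mono)
    also have "\<dots> \<le> 2 * ((cmod (f a))\<^sup>2 + (cmod (g a))\<^sup>2)"
      using zero_le_power2[of "cmod (f a) - cmod (g a)"]
      by (simp add: power2_eq_square algebra_simps)
    finally show ?thesis .
  qed
  then show ?thesis
    unfolding sqnorm_def sum.distrib[symmetric] sum_distrib_left by (rule sum_mono)
qed

text \<open>One Gram-Schmidt step; for \<open>u = 0\<close> every \<open>c\<close> serves.\<close>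

lemma orthogonal_component:
  fixes u z :: "'a::finite \<Rightarrow> complex"
  obtains c where "(\<Sum>a\<in>UNIV. u a * cnj (z a - c * u a)) = 0"
proof (cases "sqnorm u = 0")
  case True
  then show ?thesis using that[of 0] by (simp add: sqnorm_eq_0_iff)
next
  case False
  define c where "c = cnj ((\<Sum>a\<in>UNIV. u a * cnj (z a)) / of_real (sqnorm u))"
  have "(\<Sum>a\<in>UNIV. u a * cnj (z a - c * u a)) =
      (\<Sum>a\<in>UNIV. u a * cnj (z a)) - cnj c * (\<Sum>a\<in>UNIV. u a * cnj (u a))"
    by (simp add: algebra_simps sum_subtractf sum_distrib_left)
  also have "\<dots> = 0"
    using False by (simp add: c_def flip: complex_of_real_sqnorm)
  finally show ?thesis by (rule that)
qed

text \<open>Every cross term contains the inner product of \<open>u1\<close> and \<open>u2\<close>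
  as a factor, so orthogonality in the first tensor factor suffices.\<close>

lemma sqnorm_orthogonal_tensors:
  fixes u1 u2 :: "'a::finite \<Rightarrow> complex" and v1 v2 :: "'b::finite \<Rightarrow> complex"
  assumes orth: "(\<Sum>a\<in>UNIV. u1 a * cnj (u2 a)) = 0"
  shows "sqnorm (\<lambda>(a, b). u1 a * v1 b + u2 a * v2 b) = sqnorm u1 * sqnorm v1 + sqnorm u2 * sqnorm v2"
proof -
  have orth': "(\<Sum>a\<in>UNIV. u2 a * cnj (u1 a)) = 0"
    using arg_cong[OF orth, of cnj] by (simp add: mult.commute)
  have *: "(\<Sum>a\<in>UNIV. \<Sum>b\<in>UNIV. f a * cnj (f' a) * (g b * cnj (g' b))) =
      (\<Sum>a\<in>UNIV. f a * cnj (f' a)) * (\<Sum>b\<in>UNIV. g b * cnj (g' b))"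
    for f f' :: "'a \<Rightarrow> complex" and g g' :: "'b \<Rightarrow> complex"
    by (simp add: sum_product)
  have "complex_of_real (sqnorm (\<lambda>(a, b). u1 a * v1 b + u2 a * v2 b)) =
      (\<Sum>a\<in>UNIV. \<Sum>b\<in>UNIV. u1 a * cnj (u1 a) * (v1 b * cnj (v1 b))
        + u1 a * cnj (u2 a) * (v1 b * cnj (v2 b))
        + u2 a * cnj (u1 a) * (v2 b * cnj (v1 b))
        + u2 a * cnj (u2 a) * (v2 b * cnj (v2 b)))"
    unfolding sqnorm_prod by (simp add: complex_of_real_sqnorm algebra_simps)
  also have "\<dots> = complex_of_real (sqnorm u1 * sqnorm v1 + sqnorm u2 * sqnorm v2)"
    unfolding sum.distrib * orth orth' by (simp add: complex_of_real_sqnorm)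
  finally show ?thesis by (simp only: of_real_eq_iff)
qed

section \<open>Contracting a tensor of rank two with a matrix\<close>

text \<open>The bilinear pairing, without conjugation, of \<open>g\<close> with the vectorization of
  \<open>W\<close>. Pairs are ordered (column, row), as in the Choi matrix of \<open>Ad W\<close>
  for square \<open>W\<close>.\<close>

definition contract :: "complex^'n^'m \<Rightarrow> ('n \<times> 'm \<Rightarrow> complex) \<Rightarrow> complex" where
  "contract W g = (\<Sum>(m, i)\<in>UNIV. W $ i $ m * g (m, i))"

text \<open>The contraction of an elementary tensor is the bilinear form of \<open>W\<close> at
  \<open>b\<close> and \<open>a\<close>, so this bounds the squared operator norm of
  \<open>W\<close> by \<open>s\<close>.\<close>

definition bilinear_bound :: "complex^'n^'m \<Rightarrow> real \<Rightarrow> bool" where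
  "bilinear_bound W s \<longleftrightarrow>
    (\<forall>a b. (cmod (contract W (\<lambda>(m, i). a m * b i)))\<^sup>2 \<le> s * (sqnorm a * sqnorm b))"

lemma contract_add: "contract W (\<lambda>c. f c + g c) = contract W f + contract W g"
  by (simp add: contract_def algebra_simps sum.distrib split_def)

text \<open>For fixed \<open>n\<close> and \<open>j\<close> the contracted argument is the
  elementary tensor of two slices; the squared norms of the slices add up to those of
  \<open>u\<close> and \<open>v\<close>.\<close>

lemma contract_elementary_bound:
  fixes W :: "complex^'n^'m"
  assumes "bilinear_bound W s"
  shows "sqnorm (\<lambda>(n, j). contract W (\<lambda>(m, i). u (m, n) * v (i, j)))
    \<le> s * (sqnorm u * sqnorm v)"
proof -
  have "sqnorm (\<lambda>(n, j). contract W (\<lambda>(m, i). u (m, n) * v (i, j))) =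
      (\<Sum>n\<in>UNIV. \<Sum>j\<in>UNIV. (cmod (contract W (\<lambda>(m, i). u (m, n) * v (i, j))))\<^sup>2)"
    by (simp add: sqnorm_def sum.cartesian_product split_def)
  also have "\<dots> \<le> (\<Sum>n\<in>UNIV. \<Sum>j\<in>UNIV. s * (sqnorm (\<lambda>m. u (m, n)) * sqnorm (\<lambda>i. v (i, j))))"
    by (intro sum_mono) (use assms in \<open>simp add: bilinear_bound_def\<close>)
  also have "\<dots> = s * (sqnorm u * sqnorm v)"
    by (simp only: sqnorm_prod'[of u] sqnorm_prod'[of v] sum_product) (simp only: sum_distrib_left)
  finally show ?thesis .
qed

lemma contract_rank_two_bound:
  fixes W :: "complex^'n^'m"
  assumes W: "bilinear_bound W s"
  shows "sqnorm (\<lambda>(n, j). contract W (\<lambda>(m, i). z1 (m, n) * v1 (i, j) + z2 (m, n) * v2 (i, j)))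
    \<le> 2 * s * sqnorm (\<lambda>(a, b). z1 a * v1 b + z2 a * v2 b)"
proof -
  obtain c where orth: "(\<Sum>a\<in>UNIV. z1 a * cnj (z2 a - c * z1 a)) = 0"
    by (rule orthogonal_component)
  define u where "u a = z2 a - c * z1 a" for a
  \<comment> \<open>Compensates for replacing \<open>z2\<close> by its component \<open>u\<close>
    orthogonal to \<open>z1\<close>, leaving the tensor unchanged.\<close>
  define w where "w b = v1 b + c * v2 b" for b
  have eq: "z1 a * v1 b + z2 a * v2 b = z1 a * w b + u a * v2 b" for a b
    by (simp add: u_def w_def algebra_simps)
  have "sqnorm (\<lambda>(n, j). contract W (\<lambda>(m, i). z1 (m, n) * w (i, j) + u (m, n) * v2 (i, j)))
     = sqnorm (\<lambda>c. (\<lambda>(n, j). contract W (\<lambda>(m, i). z1 (m, n) * w (i, j))) c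
         + (\<lambda>(n, j). contract W (\<lambda>(m, i). u (m, n) * v2 (i, j))) c)"
    by (simp add: split_def contract_add)
  \<comment> \<open>The factor 2 is the price of splitting into two elementary tensors;
    orthogonality then makes the bracket exactly \<open>s\<close> times the squared norm of the
    tensor.\<close>
  also have "\<dots> \<le> 2 * (s * (sqnorm z1 * sqnorm w) + s * (sqnorm u * sqnorm v2))"
    by (rule order_trans[OF sqnorm_add_le])
      (intro mult_left_mono add_mono contract_elementary_bound[OF W], simp)
  also have "\<dots> = 2 * s * sqnorm (\<lambda>(a, b). z1 a * w b + u a * v2 b)"
    using sqnorm_orthogonal_tensors[of z1 u w v2] orth by (simp add: u_def algebra_simps)
  finally show ?thesis by (simp only: eq)
qed


section \<open>The quadratic form of the tensor square\<close>

lemma sqnorm_reindex: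
  assumes "bij f"
  shows "sqnorm (\<lambda>a. g (f a)) = sqnorm g"
  unfolding sqnorm_def by (rule sum.reindex_bij_betw) (use assms in simp)

lemma tensor_map_nth:
  "tensor_map \<phi> \<psi> X $ r $ c = (\<Sum>i\<in>UNIV. \<Sum>j\<in>UNIV. \<Sum>k\<in>UNIV. \<Sum>l\<in>UNIV.
    X $ (i, k) $ (j, l) * (\<phi> (munit i j) $ fst r $ fst c * \<psi> (munit k l) $ snd r $ snd c))"
  by (simp add: tensor_map_def kron_def mscale_def)

lemma tensor_map_id_outer_nth:
  "tensor_map \<phi> id (outer z) $ (p, k) $ (q, l) =
    (\<Sum>a\<in>UNIV. \<Sum>b\<in>UNIV. z $ (a, k) * cnj (z $ (b, l)) * \<phi> (munit a b) $ p $ q)"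
proof -
  have "(\<Sum>k'\<in>UNIV. \<Sum>l'\<in>UNIV. f k' l' * (x * munit k' l' $ k $ l)) = f k l * x"
    for f :: "'b \<Rightarrow> 'b \<Rightarrow> complex" and x
  proof -
    have "(\<Sum>l'\<in>UNIV. f k' l' * (x * munit k' l' $ k $ l)) = (if k' = k then f k l * x else 0)" for k'
      by (simp add: munit_def if_distrib if_distribR cong: if_cong)
    then show ?thesis by simp
  qed
  then show ?thesis
    by (simp add: tensor_map_nth outer_def)
qed

text \<open>The auxiliary index \<open>k\<close> is summed out first: \<open>z\<close> and
  \<open>x\<close> enter only through \<open>h\<close>, a sum of as many elementary tensors as
  \<open>'k\<close> has elements.\<close>

lemma cinner_tensor_map_id_outer:
  fixes z :: "complex^('a::finite \<times> 'k::finite)" and x :: "complex^('b::finite \<times> 'k)"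
  defines "h a p \<equiv> \<Sum>k\<in>UNIV. z $ (a, k) * cnj (x $ (p, k))"
  shows "cinner x (tensor_map \<phi> id (outer z) *v x) =
    (\<Sum>a\<in>UNIV. \<Sum>b\<in>UNIV. \<Sum>p\<in>UNIV. \<Sum>q\<in>UNIV. h a p * cnj (h b q) * \<phi> (munit a b) $ p $ q)"
proof -
  define T where "T p k q l a b =
    cnj (x $ (p, k)) * (z $ (a, k) * cnj (z $ (b, l)) * \<phi> (munit a b) $ p $ q * x $ (q, l))"
    for p k q l a b
  have split: "(\<Sum>r\<in>UNIV. F r) = (\<Sum>p\<in>UNIV. \<Sum>k\<in>UNIV. F (p, k))"
    for F :: "'b \<times> 'k \<Rightarrow> complex"
    by (simp add: sum.cartesian_product)
  have "cinner x (tensor_map \<phi> id (outer z) *v x) =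
      (\<Sum>p\<in>UNIV. \<Sum>k\<in>UNIV. \<Sum>q\<in>UNIV. \<Sum>l\<in>UNIV. \<Sum>a\<in>UNIV. \<Sum>b\<in>UNIV. T p k q l a b)"
    by (simp add: cinner_def matrix_vector_mult_def split tensor_map_id_outer_nth T_def
        sum_distrib_left sum_distrib_right)
  also have "\<dots> = (\<Sum>a\<in>UNIV. \<Sum>b\<in>UNIV. \<Sum>p\<in>UNIV. \<Sum>q\<in>UNIV. \<Sum>k\<in>UNIV. \<Sum>l\<in>UNIV. T p k q l a b)"
    unfolding sum.cartesian_product UNIV_Times_UNIV
    by (rule sum.reindex_bij_witness[of _ "\<lambda>(a, b, p, q, k, l). (p, k, q, l, a, b)"
          "\<lambda>(p, k, q, l, a, b). (a, b, p, q, k, l)"]) auto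
  also have "\<dots> = (\<Sum>a\<in>UNIV. \<Sum>b\<in>UNIV. \<Sum>p\<in>UNIV. \<Sum>q\<in>UNIV. h a p * cnj (h b q) * \<phi> (munit a b) $ p $ q)"
    unfolding h_def cnj_sum sum_product unfolding sum_distrib_right by (simp add: T_def mult_ac)
  finally show ?thesis .
qed

lemma Ad_munit: "Ad V (munit m m') $ i $ i' = V $ i $ m * cnj (V $ i' $ m')"
proof -
  have "(V ** munit m m') $ i $ k = (if k = m' then V $ i $ m else 0)" for k
    by (simp add: matrix_matrix_mult_def munit_def if_distrib cong: if_cong)
  then show ?thesis
    by (simp add: Ad_def matrix_matrix_mult_def[of "V ** munit m m'"] adj_def
        mult_delta_left cong: if_cong)
qed

text \<open>These are the entries of the Choi matrix, the identity minus \<open>l\<close> times a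
  rank one matrix, at row \<open>(m, i)\<close> and column \<open>(m', i')\<close>.\<close>

lemma Tr_minus_Ad_munit:
  fixes V :: "complex^'n^'n"
  shows "Tr_minus_Ad l V (munit m m') $ i $ i' =
    of_bool ((m, i) = (m', i')) - of_real l * (V $ i $ m * cnj (V $ i' $ m'))"
proof -
  have "trace (munit m m' :: complex^'n^'n) = of_bool (m = m')"
    by (auto simp: trace_def munit_def intro!: sum.neutral)
  then show ?thesis
    by (simp add: Tr_minus_Ad_def mscale_def mat_def Ad_munit)
qed

text \<open>Multiplying out the two kernels gives four terms: each Kronecker delta identifies an
  index with its primed copy, and each rank one part contracts that index with
  \<open>w\<close>.\<close>

lemma quadratic_form_expansion:
  fixes w :: "'a::finite \<Rightarrow> complex" and g :: "'a \<times> 'a \<Rightarrow> complex" and l :: real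
  shows "(\<Sum>c\<in>UNIV. \<Sum>d\<in>UNIV. \<Sum>c'\<in>UNIV. \<Sum>d'\<in>UNIV. g (c, d) * cnj (g (c', d')) *
      ((of_bool (c = c') - of_real l * (w c * cnj (w c')))
        * (of_bool (d = d') - of_real l * (w d * cnj (w d'))))) =
    of_real (sqnorm g - l * sqnorm (\<lambda>d. \<Sum>c\<in>UNIV. w c * g (c, d))
      - l * sqnorm (\<lambda>c. \<Sum>d\<in>UNIV. w d * g (c, d))
      + (l * cmod (\<Sum>c\<in>UNIV. \<Sum>d\<in>UNIV. w c * w d * g (c, d)))\<^sup>2)"
    (is "?L = ?R")
proof -
  let ?S = "\<lambda>F. \<Sum>c\<in>UNIV. \<Sum>d\<in>UNIV. \<Sum>c'\<in>UNIV. \<Sum>d'\<in>UNIV. g (c, d) * cnj (g (c', d')) * F c d c' d'"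
  have "?L = ?S (\<lambda>c d c' d'. of_bool (c = c') * of_bool (d = d'))
      - of_real l * ?S (\<lambda>c d c' d'. of_bool (d = d') * (w c * cnj (w c')))
      - of_real l * ?S (\<lambda>c d c' d'. of_bool (c = c') * (w d * cnj (w d')))
      + of_real l * (of_real l * ?S (\<lambda>c d c' d'. (w c * cnj (w c')) * (w d * cnj (w d'))))"
    unfolding sum_distrib_left sum_subtractf[symmetric] sum.distrib[symmetric]
    by (intro sum.cong refl) (simp add: algebra_simps)
  also have "?S (\<lambda>c d c' d'. of_bool (c = c') * of_bool (d = d')) = of_real (sqnorm g)"
  proof -
    have "?S (\<lambda>c d c' d'. of_bool (c = c') * of_bool (d = d')) =
        (\<Sum>c\<in>UNIV. \<Sum>d\<in>UNIV. \<Sum>c'\<in>UNIV. if c = c' then g (c, d) * cnj (g (c, d)) else 0)"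
      by (intro sum.cong refl) simp
    also have "\<dots> = of_real (sqnorm g)"
      by (simp add: sqnorm_prod[of g] complex_of_real_sqnorm)
    finally show ?thesis .
  qed
  also have "?S (\<lambda>c d c' d'. of_bool (d = d') * (w c * cnj (w c')))
      = of_real (sqnorm (\<lambda>d. \<Sum>c\<in>UNIV. w c * g (c, d)))"
  proof -
    have "?S (\<lambda>c d c' d'. of_bool (d = d') * (w c * cnj (w c'))) =
        (\<Sum>c\<in>UNIV. \<Sum>d\<in>UNIV. \<Sum>c'\<in>UNIV. w c * g (c, d) * cnj (w c' * g (c', d)))"
    proof (intro sum.cong refl)
      fix c d c'
      have "(\<Sum>d'\<in>UNIV. g (c, d) * cnj (g (c', d')) * (of_bool (d = d') * (w c * cnj (w c')))) =
          (\<Sum>d'\<in>UNIV. if d = d' then w c * g (c, d) * cnj (w c' * g (c', d)) else 0)"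
        by (intro sum.cong refl) (simp add: mult_ac)
      then show "(\<Sum>d'\<in>UNIV. g (c, d) * cnj (g (c', d')) * (of_bool (d = d') * (w c * cnj (w c')))) =
          w c * g (c, d) * cnj (w c' * g (c', d))"
        by simp
    qed
    also have "\<dots> = (\<Sum>d\<in>UNIV. \<Sum>c\<in>UNIV. \<Sum>c'\<in>UNIV. w c * g (c, d) * cnj (w c' * g (c', d)))"
      by (rule sum.swap)
    finally show ?thesis
      by (simp only: complex_of_real_sqnorm cnj_sum sum_product)
  qed
  also have "?S (\<lambda>c d c' d'. of_bool (c = c') * (w d * cnj (w d')))
      = of_real (sqnorm (\<lambda>c. \<Sum>d\<in>UNIV. w d * g (c, d)))"
  proof -
    have "?S (\<lambda>c d c' d'. of_bool (c = c') * (w d * cnj (w d'))) =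
        (\<Sum>c\<in>UNIV. \<Sum>d\<in>UNIV. \<Sum>c'\<in>UNIV. if c = c' then \<Sum>d'\<in>UNIV. w d * g (c, d) * cnj (w d' * g (c, d')) else 0)"
      by (intro sum.cong refl) (simp add: mult_ac)
    then show ?thesis
      by (simp add: complex_of_real_sqnorm sum_product)
  qed
  also have "?S (\<lambda>c d c' d'. (w c * cnj (w c')) * (w d * cnj (w d')))
      = of_real ((cmod (\<Sum>c\<in>UNIV. \<Sum>d\<in>UNIV. w c * w d * g (c, d)))\<^sup>2)"
    unfolding complex_norm_square cnj_sum sum_distrib_right unfolding sum_distrib_left
    by (simp add: mult_ac)
  finally show ?thesis
    by (simp add: power_mult_distrib power2_eq_square)
qed

lemma munit_prod: "munit a b = kron (munit (fst a) (fst b)) (munit (snd a) (snd b))"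
  by (auto simp: munit_def kron_def vec_eq_iff prod_eq_iff)

lemma cinner_tensor_square_outer:
  fixes V :: "complex^'n^'n" and z x :: "complex^(('n \<times> 'n) \<times> 'k::finite)"
  defines "h \<equiv> \<lambda>(a, p). \<Sum>k\<in>UNIV. z $ (a, k) * cnj (x $ (p, k))"
  shows "\<exists>r\<ge>0. cinner x (tensor_map (tensor_map (Tr_minus_Ad l V) (Tr_minus_Ad l V)) id (outer z) *v x) =
    of_real (sqnorm h - l * sqnorm (\<lambda>(n, j). contract V (\<lambda>(m, i). h ((m, n), (i, j))))
      - l * sqnorm (\<lambda>(m, i). contract V (\<lambda>(n, j). h ((m, n), (i, j)))) + r)"
proof -
  define w where "w c = V $ snd c $ fst c" for c
  \<comment> \<open>\<open>h\<close> groups the two inputs and the two outputs; \<open>g\<close>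
    groups input and output of each tensor factor, in which order the kernel \<open>K\<close> is a
    product.\<close>
  define g where "g = (\<lambda>((m, i), (n, j)). h ((m, n), (i, j)))"
  define K where "K a b p q = tensor_map (Tr_minus_Ad l V) (Tr_minus_Ad l V) (munit a b) $ p $ q"
    for a b p q
  have K: "K (m, n) (m', n') (i, j) (i', j') =
      (of_bool ((m, i) = (m', i')) - of_real l * (w (m, i) * cnj (w (m', i')))) *
      (of_bool ((n, j) = (n', j')) - of_real l * (w (n, j) * cnj (w (n', j'))))" for m n i j m' n' i' j'
    unfolding K_def munit_prod tensor_map_kron[OF mlinear_Tr_minus_Ad mlinear_Tr_minus_Ad]
    by (simp add: kron_def Tr_minus_Ad_munit w_def)
  have "cinner x (tensor_map (tensor_map (Tr_minus_Ad l V) (Tr_minus_Ad l V)) id (outer z) *v x) =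
      (\<Sum>a\<in>UNIV. \<Sum>b\<in>UNIV. \<Sum>p\<in>UNIV. \<Sum>q\<in>UNIV. h (a, p) * cnj (h (b, q)) * K a b p q)"
    by (simp add: cinner_tensor_map_id_outer h_def K_def)
  also have "\<dots> = (\<Sum>c\<in>UNIV. \<Sum>d\<in>UNIV. \<Sum>c'\<in>UNIV. \<Sum>d'\<in>UNIV. g (c, d) * cnj (g (c', d')) *
      ((of_bool (c = c') - of_real l * (w c * cnj (w c')))
        * (of_bool (d = d') - of_real l * (w d * cnj (w d')))))"
    unfolding sum.cartesian_product UNIV_Times_UNIV
    by (rule sum.reindex_bij_witness[of _
          "\<lambda>((m, i), (n, j), (m', i'), (n', j')). ((m, n), (m', n'), (i, j), (i', j'))"
          "\<lambda>((m, n), (m', n'), (i, j), (i', j')). ((m, i), (n, j), (m', i'), (n', j'))"])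
      (clarsimp simp del: prod.inject simp add: K g_def)+
  also note quadratic_form_expansion
  also have "sqnorm g = sqnorm h"
  proof -
    have "bij (\<lambda>((m, i), (n, j)). ((m, n), (i, j)) :: ('n \<times> 'n) \<times> ('n \<times> 'n))"
      by (rule o_bij[of "\<lambda>((m, n), (i, j)). ((m, i), (n, j))"]) auto
    from sqnorm_reindex[OF this, of h] show ?thesis
      by (simp add: g_def split_def)
  qed
  also have "(\<lambda>d. \<Sum>c\<in>UNIV. w c * g (c, d)) = (\<lambda>(n, j). contract V (\<lambda>(m, i). h ((m, n), (i, j))))"
    by (auto simp: fun_eq_iff contract_def w_def g_def split_def)
  also have "(\<lambda>c. \<Sum>d\<in>UNIV. w d * g (c, d)) = (\<lambda>(m, i). contract V (\<lambda>(n, j). h ((m, n), (i, j))))"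
    by (auto simp: fun_eq_iff contract_def w_def g_def split_def)
  finally show ?thesis
    by (intro exI[of _ "(l * cmod (\<Sum>c\<in>UNIV. \<Sum>d\<in>UNIV. w c * w d * g (c, d)))\<^sup>2"] conjI zero_le_power2)
qed

lemma psd_tensor_square_outer:
  fixes V :: "complex^'n^'n" and z :: "complex^(('n \<times> 'n) \<times> 2)"
  assumes V: "bilinear_bound V s" and l: "0 < l" "4 * s \<le> 1 / l"
  shows "psd (tensor_map (tensor_map (Tr_minus_Ad l V) (Tr_minus_Ad l V)) id (outer z))"
  unfolding psd_def
proof
  fix x :: "complex^(('n \<times> 'n) \<times> 2)"
  let ?q = "cinner x (tensor_map (tensor_map (Tr_minus_Ad l V) (Tr_minus_Ad l V)) id (outer z) *v x)"
  define u where "u k a = z $ (a, k)" for k a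
  define v where "v k p = cnj (x $ (p, k))" for k p
  \<comment> \<open>Two summands because the auxiliary index type is \<open>2\<close>; this is where
    2-positivity meets the rank two bound.\<close>
  define h where "h = (\<lambda>(a, p). u 1 a * v 1 p + u 2 a * v 2 p)"
  have h: "(\<lambda>(a, p). \<Sum>k\<in>UNIV. z $ (a, k) * cnj (x $ (p, k))) = h"
    by (simp add: h_def u_def v_def sum_2)
  obtain r where r: "r \<ge> 0" and q: "?q =
    of_real (sqnorm h - l * sqnorm (\<lambda>(n, j). contract V (\<lambda>(m, i). h ((m, n), (i, j))))
      - l * sqnorm (\<lambda>(m, i). contract V (\<lambda>(n, j). h ((m, n), (i, j)))) + r)"
    using cinner_tensor_square_outer[of x l V z] unfolding h by blast
  have first: "sqnorm (\<lambda>(n, j). contract V (\<lambda>(m, i). h ((m, n), (i, j)))) \<le> 2 * s * sqnorm h"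
    using contract_rank_two_bound[OF V, of "u 1" "v 1" "u 2" "v 2"] by (simp add: h_def)
  have second: "sqnorm (\<lambda>(m, i). contract V (\<lambda>(n, j). h ((m, n), (i, j)))) \<le> 2 * s * sqnorm h"
  proof -
    \<comment> \<open>Exchanging the two tensor factors in input and output turns this contraction
      into the first one and preserves \<open>sqnorm h\<close>.\<close>
    have "bij (\<lambda>(a, p). (prod.swap a, prod.swap p) :: ('n \<times> 'n) \<times> ('n \<times> 'n))"
      by (rule o_bij[of "\<lambda>(a, p). (prod.swap a, prod.swap p)"]) auto
    from sqnorm_reindex[OF this, of h]
      contract_rank_two_bound[OF V, of "u 1 \<circ> prod.swap" "v 1 \<circ> prod.swap" "u 2 \<circ> prod.swap"
        "v 2 \<circ> prod.swap"]
    show ?thesis by (simp add: h_def split_def)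
  qed
  have "l * (4 * s) \<le> 1"
    using l by (simp add: field_simps)
  then have "l * (4 * s) * sqnorm h \<le> 1 * sqnorm h"
    by (rule mult_right_mono) (rule sqnorm_nonneg)
  moreover have "l * sqnorm (\<lambda>(n, j). contract V (\<lambda>(m, i). h ((m, n), (i, j))))
      + l * sqnorm (\<lambda>(m, i). contract V (\<lambda>(n, j). h ((m, n), (i, j)))) \<le> l * (4 * s) * sqnorm h"
    using mult_left_mono[OF add_mono[OF first second], of l] l by (simp add: algebra_simps)
  ultimately show "Im ?q = 0 \<and> 0 \<le> Re ?q"
    unfolding q using r by simp
qed

section \<open>The S(1)-norm of the Choi matrix\<close>

text \<open>The Choi matrix of \<open>Ad V\<close> is the rank one matrix of the vectorized
  \<open>V\<close>. As \<open>contract\<close> is bilinear, the conjugation falls on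
  \<open>\<psi>\<close>.\<close>

lemma cinner_choi_Ad:
  fixes V :: "complex^'n^'n"
  shows "Re (cinner \<psi> (choi (Ad V) *v \<psi>)) = (cmod (contract V (\<lambda>c. cnj (\<psi> $ c))))\<^sup>2"
proof -
  have "choi (Ad V) $ (m, i) $ (m', i') = V $ i $ m * cnj (V $ i' $ m')" for m m' i i'
  proof -
    have "(\<Sum>b\<in>UNIV. munit a b $ m $ m' * Ad V (munit a b) $ i $ i') =
        (if a = m then V $ i $ m * cnj (V $ i' $ m') else 0)" for a
      by (simp add: Ad_munit) (simp add: munit_def mult_delta_left)
    then show ?thesis
      by (simp add: choi_def kron_def)
  qed
  then have C: "choi (Ad V) $ c $ d = V $ snd c $ fst c * cnj (V $ snd d $ fst d)" for c d
    by (metis prod.collapse)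
  have "cinner \<psi> (choi (Ad V) *v \<psi>) =
     contract V (\<lambda>c. cnj (\<psi> $ c)) * cnj (contract V (\<lambda>c. cnj (\<psi> $ c)))"
    unfolding contract_def cnj_sum sum_product
    by (simp add: cinner_def matrix_vector_mult_def C split_def sum_distrib_left mult_ac)
  then show ?thesis
    by (simp flip: complex_norm_square)
qed

text \<open>All rows of the coefficient matrix are multiples of \<open>b\<close>.\<close>

lemma schmidt_rank_elementary:
  "schmidt_rank (\<chi> c. a (fst c) * b (snd c)) \<le> 1"
proof -
  have "rows (\<chi> i j. a i * b j) \<subseteq> vec.span {\<chi> j. b j}"
  proof
    fix y assume "y \<in> rows (\<chi> i j. a i * b j)"
    then obtain i where "y = a i *s (\<chi> j. b j)"
      by (auto simp: rows_def row_def vec_eq_iff)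
    then show "y \<in> vec.span {\<chi> j. b j}"
      by (simp add: vec.span_base vec.span_scale)
  qed
  from vec.dim_le_card[OF this] show ?thesis
    by (simp add: schmidt_rank_def row_rank_def_gen)
qed

text \<open>A normalized elementary tensor is admissible in the supremum, and homogeneity removes
  the normalization.\<close>

lemma bilinear_bound_S_norm:
  fixes V :: "complex^'n^'n"
  shows "bilinear_bound V (S_norm 1 (choi (Ad V)))"
  unfolding bilinear_bound_def
proof (intro allI)
  fix a b :: "'n \<Rightarrow> complex"
  let ?g = "\<lambda>(m, i). a m * b i" and ?S = "S_norm 1 (choi (Ad V))"
  define N where "N = sqnorm a * sqnorm b"
  show "(cmod (contract V ?g))\<^sup>2 \<le> ?S * (sqnorm a * sqnorm b)"
  \<comment> \<open>The zero tensor cannot be normalized; there both sides vanish.\<close>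
  proof (cases "N = 0")
    case True
    then have "(\<forall>m. a m = 0) \<or> (\<forall>i. b i = 0)"
      by (simp add: N_def sqnorm_eq_0_iff)
    then have "contract V ?g = 0"
      by (auto simp: contract_def)
    then show ?thesis
      by (simp only: True[unfolded N_def]) simp
  next
    case False
    then have N: "N > 0"
      by (simp add: N_def less_le sqnorm_nonneg)
    \<comment> \<open>The conjugates cancel the one in \<open>cinner_choi_Ad\<close>;
      \<open>sqrt N\<close> is the norm of \<open>?g\<close>.\<close>
    define \<psi> :: "complex^('n \<times> 'n)"
      where "\<psi> = (\<chi> c. (cnj (a (fst c)) / of_real (sqrt N)) * cnj (b (snd c)))"
    have "N = sqnorm ?g"
      by (simp add: N_def sqnorm_def sum_product norm_mult power_mult_distrib
          sum.cartesian_product split_def)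
    moreover have "(cmod (\<psi> $ c))\<^sup>2 = (cmod (?g c))\<^sup>2 / N" for c
      using N by (simp add: \<psi>_def norm_mult norm_divide power_mult_distrib power_divide split_def)
    ultimately have "(\<Sum>c\<in>UNIV. (cmod (\<psi> $ c))\<^sup>2) = 1"
      using N by (simp add: sqnorm_def flip: sum_divide_distrib)
    then have "norm \<psi> = 1"
      by (simp add: norm_vec_def L2_set_def)
    moreover have "schmidt_rank \<psi> \<le> 1"
      unfolding \<psi>_def by (rule schmidt_rank_elementary)
    ultimately have "Re (cinner \<psi> (choi (Ad V) *v \<psi>)) \<le> ?S"
      unfolding S_norm_def by (intro cSup_upper bdd_above_S_norm) blast
    moreover have "contract V (\<lambda>c. cnj (\<psi> $ c)) = contract V ?g / of_real (sqrt N)"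
      by (simp add: contract_def \<psi>_def split_def sum_divide_distrib)
    ultimately have "(cmod (contract V ?g))\<^sup>2 / N \<le> ?S"
      using N by (simp add: cinner_choi_Ad norm_divide power_divide)
    then show ?thesis
      using N by (simp add: N_def divide_le_eq)
  qed
qed

theorem proposition5:
  fixes V :: "complex^'n^'n"
    and p :: "complex^('n \<times> 'n)^('n \<times> 'n)"
    and lam :: real
  assumes "p = choi (Ad V)"
    and "projection p"
    and "rank p = 1"
    and "lam > 0"
    and "1 / lam \<ge> 4 * S_norm 1 p"
  shows "k_positive TYPE(2) (tensor_map (Tr_minus_Ad lam V) (Tr_minus_Ad lam V))"
  unfolding k_positive_def
proof
  show "mlinear (tensor_map (Tr_minus_Ad lam V) (Tr_minus_Ad lam V))"
    by (rule mlinear_tensor_map)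
  show "positive_map (tensor_map (tensor_map (Tr_minus_Ad lam V) (Tr_minus_Ad lam V))
      (id :: complex^2^2 \<Rightarrow> complex^2^2))"
  proof (rule positive_map_outerI[OF mlinear_tensor_map])
    show "psd (tensor_map (tensor_map (Tr_minus_Ad lam V) (Tr_minus_Ad lam V)) id (outer z))"
      for z :: "complex^(('n \<times> 'n) \<times> 2)"
      \<comment> \<open>The bound \<open>s\<close> becomes the S(1)-norm of \<open>p\<close>, so the
        assumption on \<open>1 / lam\<close> is the required inequality.\<close>
      using assms(4,5) unfolding assms(1)
      by (rule psd_tensor_square_outer[OF bilinear_bound_S_norm])
  qed
qed

end
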